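(* Let $\varepsilon>0$ and $p\in(0,1]$. There exists $n_0=n_0(\varepsilon,p)$ such that for every graph $G\in\mathcal Q(n,p,\varepsilon)$ with $|V(G)|=n>n_0$, \[ (1-3\sqrt\varepsilon)\frac12\,n\log(pn)\ \le\ \log\mathsf{NM}(G,\sqrt\varepsilon)\ \le\ (1+3\sqrt\varepsilon)\frac12\,n\log(pn). \]
   Context: All logarithms are natural. For disjoint vertex sets $A,B$, $d_G(A,B)=\mathsf e(A,B)/(|A||B|)$ with $\mathsf e(A,B)$ the number of edges between them. $G\in\mathcal Q(n,p,\varepsilon)$ ($G$ is $(\varepsilon,p)$-quasirandom on $n$ vertices) means that for all disjoint $X,Y\subseteq V(G)$ with $|X|\ge\varepsilon|V(G)|$ and $|Y|\ge\varepsilon|V(G)|$ we have $|d_G(X,Y)-p|<\varepsilon$. A maximal matching is one not properly contained in another matching; a maximal $\eta$-near perfect matching is a maximal matching $\mathcal M$ with $|\mathcal M|\ge(1-\eta)|V(G)|/2$; $\mathsf{NM}(G,\eta)$ is the number of such matchings.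
   Formalization: The hypothesis ε<p is added: for ε=0.05, p=0.01 edgeless graphs are (ε,p)-quasirandom yet have NM=0, so the lower bound fails. Also log 0 is read as 0, which matters only when ε≥1/9, where the lower bound is nonpositive. *)

theory Defs
  imports Complex_Main
begin

definition simple_graph :: "'a set \<Rightarrow> 'a set set \<Rightarrow> bool" where
  "simple_graph V E \<longleftrightarrow> finite V \<and> (\<forall>e\<in>E. e \<subseteq> V \<and> card e = 2)"

definition edges_between :: "'a set set \<Rightarrow> 'a set \<Rightarrow> 'a set \<Rightarrow> 'a set set" where
  "edges_between E X Y = {e \<in> E. \<exists>x\<in>X. \<exists>y\<in>Y. e = {x, y}}"

definition edge_density :: "'a set set \<Rightarrow> 'a set \<Rightarrow> 'a set \<Rightarrow> real" where
  "edge_density E X Y = real (card (edges_between E X Y)) / (real (card X) * real (card Y))"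

(* Membership of the graph (V, E) in Q(n, p, eps). For eps >= p the lower density bound
   is void, and edgeless graphs on V satisfy the condition. *)
definition quasirandom :: "nat \<Rightarrow> real \<Rightarrow> real \<Rightarrow> 'a set \<Rightarrow> 'a set set \<Rightarrow> bool" where
  "quasirandom n p \<epsilon> V E \<longleftrightarrow>
     simple_graph V E \<and> card V = n \<and>
     (\<forall>X Y. X \<subseteq> V \<longrightarrow> Y \<subseteq> V \<longrightarrow> X \<inter> Y = {} \<longrightarrow>
        real (card X) \<ge> \<epsilon> * real (card V) \<longrightarrow> real (card Y) \<ge> \<epsilon> * real (card V) \<longrightarrow>
        \<bar>edge_density E X Y - p\<bar> < \<epsilon>)"

definition matching :: "'a set set \<Rightarrow> 'a set set \<Rightarrow> bool" where
  "matching E M \<longleftrightarrow> M \<subseteq> E \<and> (\<forall>e\<in>M. \<forall>f\<in>M. e \<noteq> f \<longrightarrow> e \<inter> f = {})"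

definition maximal_matching :: "'a set set \<Rightarrow> 'a set set \<Rightarrow> bool" where
  "maximal_matching E M \<longleftrightarrow> matching E M \<and> (\<nexists>M'. matching E M' \<and> M \<subset> M')"

definition maximal_near_perfect_matching ::
    "'a set \<Rightarrow> 'a set set \<Rightarrow> real \<Rightarrow> 'a set set \<Rightarrow> bool" where
  "maximal_near_perfect_matching V E \<eta> M \<longleftrightarrow>
     maximal_matching E M \<and> real (card M) \<ge> (1 - \<eta>) * real (card V) / 2"

definition NM :: "'a set \<Rightarrow> 'a set set \<Rightarrow> real \<Rightarrow> nat" where
  "NM V E \<eta> = card {M. maximal_near_perfect_matching V E \<eta> M}"

end

theory Submission
  imports Defs "HOL-Library.FuncSet"
begin

text \<open>
  Write \<open>s = sqrt \<epsilon>\<close>; only the terms of order \<open>n log n\<close> matter, since \<open>p\<close> and \<open>\<epsilon>\<close> are fixed.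
  For the upper bound, choosing one endpoint of each edge shows that there are at most
  \<open>2\<^sup>n n\<^bsup>n/2\<^esup>\<close> matchings. For the lower bound let \<open>s < 1/3\<close> (otherwise the left-hand side is
  nonpositive). A matching with fewer than \<open>(1 - s) n / 2\<close> edges leaves more than \<open>s n\<close> vertices
  uncovered, and two halves of this set span at least \<open>c n\<^sup>2\<close> edges with \<open>c = (p - \<epsilon>) \<epsilon>\<^sup>2\<close>.
  Double counting the pairs of a matching and an edge that extends it yields at least
  \<open>(c n)\<^sup>k\<close> matchings of size \<open>k = \<lceil>(1 - s) n / 2\<rceil>\<close>. Each of them lies in a maximal matching, and
  a maximal matching contains at most \<open>2\<^sup>n\<close> of them.
\<close>

section \<open>Matchings in simple graphs\<close>

lemma simple_graph_finite_edges: "simple_graph V E \<Longrightarrow> finite E"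
  unfolding simple_graph_def by (meson PowI finite_Pow_iff finite_subset subsetI)

lemma finite_matchings: "finite E \<Longrightarrow> finite {M. matching E M \<and> P M}"
  by (rule finite_subset[of _ "Pow E"]) (auto simp: matching_def)

lemma card_Union_matching:
  assumes "simple_graph V E" "matching E M"
  shows "card (\<Union>M) = 2 * card M"
proof -
  have ME: "M \<subseteq> E" and fin: "finite V"
    using assms by (auto simp: matching_def simple_graph_def)
  have "card (\<Union>M) = sum card M"
  proof (rule card_Union_disjoint)
    show "pairwise disjnt M"
      using assms(2) by (auto simp: matching_def pairwise_def disjnt_def)
    show "finite e" if "e \<in> M" for e
      using that ME assms(1) by (meson fin finite_subset simple_graph_def subsetD)
  qed
  also have "\<dots> = (\<Sum>e\<in>M. 2)"
    using ME assms(1) by (intro sum.cong) (auto simp: simple_graph_def)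
  finally show ?thesis by simp
qed

lemma card_matching_le:
  assumes "simple_graph V E" "matching E M"
  shows "2 * card M \<le> card V"
proof -
  have "\<Union>M \<subseteq> V" "finite V"
    using assms by (auto simp: matching_def simple_graph_def)
  then show ?thesis
    using card_Union_matching[OF assms] card_mono by metis
qed

lemma ex_maximal_matching:
  assumes "finite E" "matching E M"
  obtains M' where "M \<subseteq> M'" "maximal_matching E M'"
proof -
  let ?S = "{M'. matching E M' \<and> M \<subseteq> M'}"
  have fin: "finite ?S" "?S \<noteq> {}"
    using assms finite_matchings by auto
  obtain M' where M': "matching E M'" "M \<subseteq> M'"
    and max: "\<And>N. matching E N \<Longrightarrow> M \<subseteq> N \<Longrightarrow> M' \<subseteq> N \<Longrightarrow> M' = N"
    using finite_has_maximal[OF fin] assms(2) by auto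
  then have "maximal_matching E M'"
    unfolding maximal_matching_def by (metis order.trans psubsetE subset_refl)
  then show thesis using M' that by blast
qed

section \<open>Upper bound on the number of matchings\<close>

text \<open>Encodes a matching by a set \<open>A\<close> of chosen endpoints and a partner map
  \<open>f\<close>. The pair \<open>(A, f)\<close> determines \<open>M\<close>, so counting such
  pairs bounds the number of matchings.\<close>

lemma matching_choose_endpoints:
  assumes G: "simple_graph V E" and M: "matching E M"
  obtains A f where "A \<subseteq> V" "card A = card M" "f \<in> A \<rightarrow>\<^sub>E V" "M = (\<lambda>a. {a, f a}) ` A"
proof -
  have "\<exists>x y. e = {x, y} \<and> x \<in> V \<and> y \<in> V" if "e \<in> M" for e
  proof -
    have "card e = 2" "e \<subseteq> V"
      using that G M by (auto simp: simple_graph_def matching_def)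
    then show ?thesis by (auto simp: card_2_iff)
  qed
  then have "\<forall>e\<in>M. \<exists>q. e = {fst q, snd q} \<and> fst q \<in> V \<and> snd q \<in> V"
    by simp
  then obtain q where q: "\<forall>e\<in>M. e = {fst (q e), snd (q e)} \<and> fst (q e) \<in> V \<and> snd (q e) \<in> V"
    by (rule bchoice[THEN exE])
  define g h where "g = fst \<circ> q" and "h = snd \<circ> q"
  have eq: "e = {g e, h e}" and gV: "g e \<in> V" and hV: "h e \<in> V" if "e \<in> M" for e
    using bspec[OF q that] by (simp_all only: g_def h_def o_apply)
  \<comment> \<open>Distinct edges of a matching are disjoint, so an endpoint determines its
    edge.\<close>
  have inj: "inj_on g M"
  proof (rule inj_onI)
    fix d e assume de: "d \<in> M" "e \<in> M" "g d = g e"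
    have "g d \<in> d" "g e \<in> e"
      using eq[OF de(1)] eq[OF de(2)] by blast+
    then show "d = e"
      using M de unfolding matching_def by (metis disjoint_iff)
  qed
  \<comment> \<open>From an endpoint go back to its edge, then to the other end;
    \<open>restrict\<close> makes \<open>f\<close> extensional, as
    \<open>\<rightarrow>\<^sub>E\<close> demands.\<close>
  define f where "f = restrict (h \<circ> the_inv_into M g) (g ` M)"
  have f: "f (g e) = h e" if "e \<in> M" for e
    using that inj by (simp add: f_def the_inv_into_f_f)
  show thesis
  proof
    show "g ` M \<subseteq> V" using gV by blast
    show "card (g ` M) = card M" using inj by (rule card_image)
    show "f \<in> g ` M \<rightarrow>\<^sub>E V"
    proof (rule PiE_I)
      show "f a \<in> V" if "a \<in> g ` M" for a
        using that f hV by auto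
    qed (simp add: f_def)
    show "M = (\<lambda>a. {a, f a}) ` (g ` M)"
    proof -
      have "(\<lambda>a. {a, f a}) ` (g ` M) = (\<lambda>e. e) ` M"
        unfolding image_image
      proof (rule image_cong[OF refl])
        show "{g e, f (g e)} = e" if "e \<in> M" for e
          using eq[OF that] f[OF that] by simp
      qed
      then show ?thesis by simp
    qed
  qed
qed

text \<open>Counts the pairs \<open>(A, f)\<close>: at most \<open>2 ^ n\<close> sets
  \<open>A\<close>, and for each of them \<open>n ^ card A\<close> maps, where \<open>card A\<close>
  is at most half of \<open>n = card V\<close>.\<close>

lemma card_matchings_le:
  assumes G: "simple_graph V E" and pos: "0 < card V"
  shows "card {M. matching E M} \<le> 2 ^ card V * card V ^ (card V div 2)"
proof -
  let ?n = "card V"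
  have fin: "finite V" using G by (simp add: simple_graph_def)
  define As where "As = {A. A \<subseteq> V \<and> card A \<le> ?n div 2}"
  define S where "S = (SIGMA A:As. A \<rightarrow>\<^sub>E V)"
  have finA: "finite As" "As \<subseteq> Pow V" using fin by (auto simp: As_def)
  have finS: "finite S"
    unfolding S_def using finA fin
    by (intro finite_SigmaI finite_PiE) (auto simp: As_def intro: finite_subset)
  have sub: "{M. matching E M} \<subseteq> (\<lambda>(A, f). (\<lambda>a. {a, f a}) ` A) ` S"
  proof
    fix M assume "M \<in> {M. matching E M}"
    then have M: "matching E M" by simp
    obtain A f where "A \<subseteq> V" "card A = card M" "f \<in> A \<rightarrow>\<^sub>E V" "M = (\<lambda>a. {a, f a}) ` A"
      using matching_choose_endpoints[OF G M] .
    moreover have "card M \<le> ?n div 2" using card_matching_le[OF G M] by simp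
    ultimately have "(A, f) \<in> S" "M = (\<lambda>(A, f). (\<lambda>a. {a, f a}) ` A) (A, f)"
      by (auto simp: S_def As_def)
    then show "M \<in> (\<lambda>(A, f). (\<lambda>a. {a, f a}) ` A) ` S" by blast
  qed
  have "card {M. matching E M} \<le> card S"
    using sub finS by (meson card_image_le card_mono finite_imageI order.trans)
  also have "\<dots> = (\<Sum>A\<in>As. card (A \<rightarrow>\<^sub>E V))"
    unfolding S_def using finA fin
    by (intro card_SigmaI ballI finite_PiE) (auto simp: As_def intro: finite_subset)
  also have "\<dots> \<le> (\<Sum>A\<in>As. ?n ^ (?n div 2))"
  proof (rule sum_mono)
    fix A assume "A \<in> As"
    then have "finite A" "card A \<le> ?n div 2" using fin by (auto simp: As_def intro: finite_subset)
    then show "card (A \<rightarrow>\<^sub>E V) \<le> ?n ^ (?n div 2)"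
      using pos by (simp add: card_funcsetE power_increasing)
  qed
  also have "\<dots> \<le> 2 ^ ?n * ?n ^ (?n div 2)"
    using card_mono[OF _ finA(2)] fin by (simp add: card_Pow)
  finally show ?thesis .
qed

section \<open>Lower bound on the number of matchings\<close>

text \<open>Halving \<open>R\<close> gives disjoint sets to which quasirandomness applies, and every
  edge between them lies in \<open>R\<close>.\<close>

lemma quasirandom_card_edges_within:
  assumes Q: "quasirandom n p \<epsilon> V E" and "0 < \<epsilon>" "\<epsilon> < p" "0 < n"
    and R: "R \<subseteq> V" "2 * \<epsilon> * real n + 1 \<le> real (card R)"
  shows "(p - \<epsilon>) * (\<epsilon> * real n)\<^sup>2 \<le> real (card {e \<in> E. e \<subseteq> R})"
proof -
  have G: "simple_graph V E" and n: "card V = n"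
    using Q by (auto simp: quasirandom_def)
  have finR: "finite R" using G R(1) by (auto simp: simple_graph_def intro: finite_subset)
  have finE: "finite E" using G by (rule simple_graph_finite_edges)
  obtain X where X: "X \<subseteq> R" "card X = card R div 2"
    using obtain_subset_with_card_n[of "card R div 2" R] by auto
  define Y where "Y = R - X"
  have cY: "card Y = card R - card R div 2"
    using X finR by (simp add: Y_def card_Diff_subset finite_subset)
  \<comment> \<open>The \<open>+ 1\<close> in the bound on \<open>card R\<close> pays for the
    rounding in \<open>card R div 2\<close>.\<close>
  have big: "\<epsilon> * real n \<le> real (card X)" "\<epsilon> * real n \<le> real (card Y)"
    using R(2) X(2) cY by linarith+
  have "X \<subseteq> V" "Y \<subseteq> V" "X \<inter> Y = {}"
    using X(1) R(1) by (auto simp: Y_def)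
  then have "\<bar>edge_density E X Y - p\<bar> < \<epsilon>"
    using Q big n unfolding quasirandom_def by blast
  then have dens: "p - \<epsilon> \<le> edge_density E X Y" by linarith
  have "0 < \<epsilon> * real n" using assms by simp
  then have posXY: "0 < real (card X)" "0 < real (card Y)" using big by linarith+
  have "(p - \<epsilon>) * (\<epsilon> * real n)\<^sup>2 \<le> (p - \<epsilon>) * (real (card X) * real (card Y))"
    using big assms unfolding power2_eq_square by (intro mult_left_mono mult_mono) auto
  also have "\<dots> \<le> real (card (edges_between E X Y))"
    using dens posXY by (simp add: edge_density_def pos_le_divide_eq)
  also have "\<dots> \<le> real (card {e \<in> E. e \<subseteq> R})"
    using finE X(1) unfolding edges_between_def Y_def
    by (intro of_nat_mono card_mono) auto
  finally show ?thesis .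
qed

text \<open>Double counting: adding \<open>e\<close> to \<open>M\<close> maps pairs of a
  \<open>k\<close>-matching and an edge avoiding it injectively to pairs of a
  \<open>Suc k\<close>-matching and one of its \<open>Suc k\<close> edges.\<close>

lemma card_matchings_Suc_ge:
  assumes finE: "finite E" and ne: "{} \<notin> E"
    and ext: "\<And>M. matching E M \<Longrightarrow> card M = k \<Longrightarrow> b \<le> real (card {e \<in> E. e \<inter> \<Union>M = {}})"
  shows "b * real (card {M. matching E M \<and> card M = k})
    \<le> real (Suc k) * real (card {M. matching E M \<and> card M = Suc k})"
proof -
  let ?N = "\<lambda>k. {M. matching E M \<and> card M = k}"
  define S where "S = (SIGMA M:?N k. {e \<in> E. e \<inter> \<Union>M = {}})"
  define T where "T = (SIGMA M:?N (Suc k). M)"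
  have finM: "finite M" if "matching E M" for M
    using that finE by (auto simp: matching_def intro: finite_subset)
  \<comment> \<open>The added edge is new, since it is nonempty; hence deleting it recovers
    \<open>M\<close>, which gives injectivity.\<close>
  have notin: "e \<notin> M" if "e \<in> E" "e \<inter> \<Union>M = {}" for e M
  proof
    assume "e \<in> M"
    then have "e \<subseteq> \<Union>M" by (rule Union_upper)
    then have "e = {}" using that(2) by (simp add: Int_absorb2)
    then show False using that(1) ne by simp
  qed
  have "inj_on (\<lambda>(M, e). (insert e M, e)) S"
  proof (rule inj_on_inverseI)
    show "(\<lambda>(M, e). (M - {e}, e)) ((\<lambda>(M, e). (insert e M, e)) x) = x" if "x \<in> S" for x
      using that notin by (cases x) (simp add: S_def)
  qed
  moreover have "(\<lambda>(M, e). (insert e M, e)) ` S \<subseteq> T"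
  proof (clarsimp simp: S_def T_def)
    fix M e assume *: "e \<in> E" "matching E M" "e \<inter> \<Union>M = {}" "k = card M"
    have "e \<notin> M" using *(1,3) by (rule notin)
    moreover have "e \<inter> d = {}" if "d \<in> M" for d
      using *(3) that by auto
    then have "matching E (insert e M)"
      using *(1,2) by (auto simp add: matching_def Int_commute)
    ultimately show "matching E (insert e M) \<and> card (insert e M) = Suc (card M)"
      using finM[OF *(2)] by simp
  qed
  moreover have "finite T"
    unfolding T_def using finM finite_matchings[OF finE] by (intro finite_SigmaI) auto
  ultimately have le: "card S \<le> card T" by (rule card_inj_on_le)
  have "card S = (\<Sum>M\<in>?N k. card {e \<in> E. e \<inter> \<Union>M = {}})"
    unfolding S_def using finite_matchings[OF finE] finE by (intro card_SigmaI) auto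
  then have "b * real (card (?N k)) \<le> real (card S)"
    using sum_mono[of "?N k" "\<lambda>_. b" "\<lambda>M. real (card {e \<in> E. e \<inter> \<Union>M = {}})"] ext
    by (simp add: mult.commute)
  also have "card T = (\<Sum>M\<in>?N (Suc k). card M)"
    unfolding T_def using finite_matchings[OF finE] finM by (intro card_SigmaI) auto
  then have "real (card S) \<le> real (Suc k) * real (card (?N (Suc k)))"
    using le by (simp add: mult.commute del: of_nat_Suc flip: of_nat_mult)
  finally show ?thesis .
qed

text \<open>Iterates the double counting from the empty matching. The last hypothesis says that
  before each of the \<open>k\<close> extensions the \<open>n - 2 * j\<close> uncovered vertices
  still suffice for the edge bound.\<close>

lemma quasirandom_card_matchings_ge:
  assumes Q: "quasirandom n p \<epsilon> V E" and "0 < \<epsilon>" "\<epsilon> < p" "0 < n"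
    and "\<And>j. j < k \<Longrightarrow> 2 * \<epsilon> * real n + 1 \<le> real n - 2 * real j"
  shows "((p - \<epsilon>) * \<epsilon>\<^sup>2 * real n) ^ k \<le> real (card {M. matching E M \<and> card M = k})"
  using assms(5)
proof (induction k)
  case 0
  have "{M. matching E M \<and> card M = 0} \<noteq> {}"
    by (auto simp: matching_def intro!: exI[of _ "{}"])
  moreover have "finite E"
    using Q simple_graph_finite_edges by (auto simp: quasirandom_def)
  then have "finite {M. matching E M \<and> card M = 0}" by (rule finite_matchings)
  ultimately have "card {M. matching E M \<and> card M = 0} \<noteq> 0" by (simp only: card_eq_0_iff simp_thms)
  then show ?case by simp
next
  case (Suc k)
  let ?c = "(p - \<epsilon>) * \<epsilon>\<^sup>2"
  let ?m = "\<lambda>k. real (card {M. matching E M \<and> card M = k})"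
  have G: "simple_graph V E" and n: "card V = n"
    using Q by (auto simp: quasirandom_def)
  have finV: "finite V" using G by (simp add: simple_graph_def)
  have c: "0 < ?c" using assms by simp
  have room: "2 * \<epsilon> * real n + 1 \<le> real n - 2 * real k" using Suc.prems by simp
  have ext: "?c * (real n)\<^sup>2 \<le> real (card {e \<in> E. e \<inter> \<Union>M = {}})"
    if M: "matching E M" and k: "card M = k" for M
  proof -
    have sub: "\<Union>M \<subseteq> V" using G M by (auto simp: matching_def simple_graph_def)
    then have "card (V - \<Union>M) = n - 2 * k"
      using card_Union_matching[OF G M] finV n k by (simp add: card_Diff_subset finite_subset)
    then have "2 * \<epsilon> * real n + 1 \<le> real (card (V - \<Union>M))"
      using room by linarith
    then have "(p - \<epsilon>) * (\<epsilon> * real n)\<^sup>2 \<le> real (card {e \<in> E. e \<subseteq> V - \<Union>M})"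
      by (intro quasirandom_card_edges_within[OF Q]) (use assms in auto)
    also have "{e \<in> E. e \<subseteq> V - \<Union>M} = {e \<in> E. e \<inter> \<Union>M = {}}"
      using G by (auto simp: simple_graph_def)
    finally show ?thesis by (simp add: power_mult_distrib mult.assoc)
  qed
  have "{} \<notin> E" using G by (auto simp: simple_graph_def)
  then have step: "?c * (real n)\<^sup>2 * ?m k \<le> real (Suc k) * ?m (Suc k)"
    using card_matchings_Suc_ge[OF simple_graph_finite_edges[OF G]] ext by blast
  have "0 \<le> 2 * \<epsilon> * real n" using assms by simp
  \<comment> \<open>Estimating the divisor \<open>Suc k\<close> by \<open>n\<close> cancels one
    factor of \<open>n\<^sup>2\<close>, so each extension gains a factor
    \<open>?c * n\<close>.\<close>
  then have "Suc k \<le> n" using room by linarith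
  then have "real (Suc k) * ?m (Suc k) \<le> real n * ?m (Suc k)"
    by (intro mult_right_mono) auto
  with step have "real n * (?c * real n * ?m k) \<le> real n * ?m (Suc k)"
    by (simp add: power2_eq_square mult_ac)
  then have "?c * real n * ?m k \<le> ?m (Suc k)"
    using \<open>0 < n\<close> by simp
  moreover have "?c * real n * (?c * real n) ^ k \<le> ?c * real n * ?m k"
    using c Suc.IH Suc.prems by (intro mult_left_mono) auto
  ultimately show ?case by simp
qed

text \<open>Extend each \<open>k\<close>-matching to a maximal one, which is near perfect because
  \<open>k\<close> is already large enough; a maximal matching has at most \<open>2 ^ card V\<close>
  subsets.\<close>

lemma card_matchings_le_NM:
  assumes G: "simple_graph V E" and k: "(1 - \<eta>) * real (card V) / 2 \<le> real k"
  shows "card {M. matching E M \<and> card M = k} \<le> NM V E \<eta> * 2 ^ card V"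
proof -
  let ?P = "{M. maximal_near_perfect_matching V E \<eta> M}"
  have finE: "finite E" using G by (rule simple_graph_finite_edges)
  have mat: "matching E M" if "M \<in> ?P" for M
    using that by (simp add: maximal_near_perfect_matching_def maximal_matching_def)
  have finM: "finite M" if "M \<in> ?P" for M
    using mat[OF that] finE by (auto simp: matching_def intro: finite_subset)
  have finP: "finite ?P"
    by (rule finite_subset[OF _ finite_matchings[OF finE, of "\<lambda>_. True"]]) (use mat in auto)
  have "{M. matching E M \<and> card M = k} \<subseteq> (\<Union>M\<in>?P. Pow M)"
  proof
    fix M assume "M \<in> {M. matching E M \<and> card M = k}"
    then have M: "matching E M" "card M = k" by auto
    obtain M' where M': "M \<subseteq> M'" "maximal_matching E M'"
      using ex_maximal_matching[OF finE M(1)] .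
    have "M' \<subseteq> E" using M'(2) by (simp add: maximal_matching_def matching_def)
    then have "k \<le> card M'" using M' M(2) finE by (metis card_mono finite_subset)
    then have "M' \<in> ?P" using M' k by (simp add: maximal_near_perfect_matching_def)
    then show "M \<in> (\<Union>M\<in>?P. Pow M)" using M'(1) by blast
  qed
  then have "card {M. matching E M \<and> card M = k} \<le> card (\<Union>M\<in>?P. Pow M)"
    using finP finM by (intro card_mono) auto
  also have "\<dots> \<le> (\<Sum>M\<in>?P. card (Pow M))"
    using finP by (rule card_UN_le)
  also have "\<dots> \<le> (\<Sum>M\<in>?P. 2 ^ card V)"
  proof (rule sum_mono)
    fix M assume M: "M \<in> ?P"
    have "card M \<le> card V" using card_matching_le[OF G mat[OF M]] by simp
    then show "card (Pow M) \<le> 2 ^ card V" using finM[OF M] by (simp add: card_Pow)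
  qed
  also have "\<dots> = NM V E \<eta> * 2 ^ card V" by (simp add: NM_def)
  finally show ?thesis .
qed

section \<open>Comparison with the leading term\<close>

lemma ln_NM_le:
  assumes G: "simple_graph V E" and pos: "0 < card V"
  shows "ln (real (NM V E \<eta>)) \<le> real (card V) * ln 2 + real (card V) / 2 * ln (real (card V))"
\<comment> \<open>With no such matching the left-hand side is \<open>ln 0 = 0\<close>.\<close>
proof (cases "NM V E \<eta> = 0")
  case True
  then show ?thesis using pos by simp
next
  case False
  let ?n = "card V"
  have "NM V E \<eta> \<le> card {M. matching E M}"
    unfolding NM_def
    using finite_matchings[OF simple_graph_finite_edges[OF G], of "\<lambda>_. True"]
    by (intro card_mono) (auto simp: maximal_near_perfect_matching_def maximal_matching_def)
  also note card_matchings_le[OF assms]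
  finally have "real (NM V E \<eta>) \<le> real (2 ^ ?n * ?n ^ (?n div 2))" by (rule of_nat_mono)
  then have "ln (real (NM V E \<eta>)) \<le> ln (real (2 ^ ?n * ?n ^ (?n div 2)))"
    using False pos by (subst ln_le_cancel_iff) auto
  also have "\<dots> = real ?n * ln 2 + real (?n div 2) * ln (real ?n)"
    using pos by (simp add: ln_mult ln_realpow)
  also have "\<dots> \<le> real ?n * ln 2 + real ?n / 2 * ln (real ?n)"
    using pos by (intro add_left_mono mult_right_mono) auto
  finally show ?thesis .
qed

lemma ln_NM_ge:
  assumes Q: "quasirandom n p \<epsilon> V E" and "0 < \<epsilon>" "\<epsilon> < p" "0 < n"
    and "sqrt \<epsilon> \<le> 1 / 3" "3 / sqrt \<epsilon> \<le> real n" "1 \<le> (p - \<epsilon>) * \<epsilon>\<^sup>2 * real n"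
  shows "(1 - sqrt \<epsilon>) / 2 * real n * ln ((p - \<epsilon>) * \<epsilon>\<^sup>2 * real n) - real n * ln 2
    \<le> ln (real (NM V E (sqrt \<epsilon>)))"
proof -
  define s where "s = sqrt \<epsilon>"
  have s: "0 < s" "s \<le> 1 / 3" "3 / s \<le> real n" and eps: "\<epsilon> = s * s"
    using assms by (simp_all add: s_def)
  define x where "x = (p - \<epsilon>) * \<epsilon>\<^sup>2 * real n"
  have x: "1 \<le> x" using assms by (simp add: x_def)
  have G: "simple_graph V E" and n: "card V = n"
    using Q by (auto simp: quasirandom_def)
  define k where "k = nat \<lceil>(1 - s) * real n / 2\<rceil>"
  have k: "(1 - s) * real n / 2 \<le> real k"
    unfolding k_def by linarith
  have "x ^ k \<le> real (card {M. matching E M \<and> card M = k})"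
    unfolding x_def
  proof (rule quasirandom_card_matchings_ge[OF Q])
    fix j assume "j < k"
    \<comment> \<open>\<open>k\<close> is a ceiling, so any smaller integer is below the unrounded
      value, and more than \<open>s * n\<close> vertices are uncovered.\<close>
    then have "real j < (1 - s) * real n / 2"
      unfolding k_def by linarith
    then have "s * real n \<le> real n - 2 * real j"
      by (simp add: algebra_simps)
    \<comment> \<open>As \<open>s \<le> 1 / 3\<close>, the term \<open>2 * \<epsilon> * n\<close>
      takes at most two thirds of \<open>s * n\<close>; as \<open>s * n \<ge> 3\<close>, the
      remaining third covers the \<open>1\<close>.\<close>
    moreover have "2 * \<epsilon> * real n + 1 \<le> s * real n"
    proof -
      have "3 \<le> s * real n" using s by (simp add: pos_divide_le_eq mult.commute)
      moreover have "s * (s * real n) \<le> 1 / 3 * (s * real n)"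
        using s by (intro mult_right_mono) auto
      ultimately show ?thesis by (simp add: eps)
    qed
    ultimately show "2 * \<epsilon> * real n + 1 \<le> real n - 2 * real j" by linarith
  qed (use assms in auto)
  also have "\<dots> \<le> real (NM V E s * 2 ^ n)"
    using card_matchings_le_NM[OF G, of s k] k n by (intro of_nat_mono) simp
  finally have le: "x ^ k \<le> real (NM V E s) * 2 ^ n" by simp
  have "0 < x ^ k" using x by simp
  then have "0 < real (NM V E s) * 2 ^ n" using le by linarith
  \<comment> \<open>Positivity lets the logarithm of the product split below.\<close>
  then have NM: "0 < real (NM V E s)" by (simp add: zero_less_mult_iff)
  have "(1 - s) / 2 * real n * ln x \<le> real k * ln x"
    using k x by (intro mult_right_mono) auto
  also have "\<dots> = ln (x ^ k)" using x by (simp add: ln_realpow)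
  also have "\<dots> \<le> ln (real (NM V E s) * 2 ^ n)"
    using le \<open>0 < x ^ k\<close> \<open>0 < real (NM V E s) * 2 ^ n\<close> by (subst ln_le_cancel_iff) auto
  also have "\<dots> = ln (real (NM V E s)) + real n * ln 2"
    using NM by (simp add: ln_mult ln_realpow)
  finally show ?thesis by (simp add: s_def x_def)
qed

theorem theorem3p2:
  fixes \<epsilon> p :: real
  assumes "0 < \<epsilon>" and "0 < p" and "p \<le> 1" and "\<epsilon> < p"
  shows "\<exists>n0::nat. \<forall>n>n0. \<forall>(V::'a set) E. quasirandom n p \<epsilon> V E \<longrightarrow>
           (1 - 3 * sqrt \<epsilon>) * (1 / 2) * real n * ln (p * real n) \<le> ln (real (NM V E (sqrt \<epsilon>))) \<and>
           ln (real (NM V E (sqrt \<epsilon>))) \<le> (1 + 3 * sqrt \<epsilon>) * (1 / 2) * real n * ln (p * real n)"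
proof -
  define s where "s = sqrt \<epsilon>"
  have s: "0 < s" using assms by (simp add: s_def)
  \<comment> \<open>The edge-count constant; it is positive because
    \<open>\<epsilon> < p\<close>.\<close>
  define c where "c = (p - \<epsilon>) * \<epsilon>\<^sup>2"
  have c: "0 < c" using assms by (simp add: c_def)
  \<comment> \<open>Solving \<open>2 * ln 2 + ln n \<le> (1 + 3 * s) * (ln p + ln n)\<close> for
    \<open>ln n\<close> gives \<open>K\<close>. Solving \<open>(1 - 3 * s) * (ln p + ln n) \<le> (1
    - s) * (ln c + ln n) - 2 * ln 2\<close> gives \<open>L\<close>; the slack is
    \<open>3 * s * ln n\<close> and \<open>2 * s * ln n\<close> respectively.\<close>
  define K where "K = (2 * ln 2 - (1 + 3 * s) * ln p) / (3 * s)"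
  define L where "L = ((1 - 3 * s) * ln p - (1 - s) * ln c + 2 * ln 2) / (2 * s)"
  have ln_top: "filterlim (\<lambda>n. ln (real n)) at_top sequentially"
    by (rule filterlim_compose[OF ln_at_top filterlim_real_sequentially])
  \<comment> \<open>The bounds \<open>3 / s\<close> and \<open>1 / c\<close> serve the lower
    estimate for \<open>s \<le> 1 / 3\<close>; \<open>1 / p\<close> makes \<open>ln (p * n)\<close>
    nonnegative for larger \<open>s\<close>.\<close>
  have "\<forall>\<^sub>F n in sequentially. 0 < n \<and> 3 / s \<le> real n \<and> 1 / c \<le> real n \<and> 1 / p \<le> real n
      \<and> K \<le> ln (real n) \<and> L \<le> ln (real n)"
    using ln_top filterlim_real_sequentially eventually_gt_at_top[of "0::nat"]
    unfolding filterlim_at_top by (intro eventually_conj) auto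
  then obtain n0 where n0: "\<And>n. n0 \<le> n \<Longrightarrow> 0 < n \<and> 3 / s \<le> real n \<and> 1 / c \<le> real n
      \<and> 1 / p \<le> real n \<and> K \<le> ln (real n) \<and> L \<le> ln (real n)"
    unfolding eventually_sequentially by blast
  show ?thesis
  proof (intro exI[of _ n0] allI impI, fold s_def)
    fix n and V :: "'a set" and E
    assume "n0 < n" and Q: "quasirandom n p \<epsilon> V E"
    then have n: "0 < n" "3 / s \<le> real n" "1 / c \<le> real n" "1 / p \<le> real n"
      and K: "K \<le> ln (real n)" and L: "L \<le> ln (real n)"
      using n0[of n] by auto
    have G: "simple_graph V E" and cV: "card V = n"
      using Q by (auto simp: quasirandom_def)
    have cn: "1 \<le> c * real n" using n(3) c by (simp add: pos_divide_le_eq mult.commute)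
    have pn: "1 \<le> p * real n" using n(4) assms by (simp add: pos_divide_le_eq mult.commute)
    have lnc: "ln (c * real n) = ln c + ln (real n)"
      and lnp: "ln (p * real n) = ln p + ln (real n)"
      using c assms n(1) by (simp_all add: ln_mult)
    have "2 * ln 2 + ln (real n) \<le> (1 + 3 * s) * ln (p * real n)"
      using K s unfolding K_def lnp by (simp add: pos_divide_le_eq algebra_simps)
    then have "real n / 2 * (2 * ln 2 + ln (real n)) \<le> real n / 2 * ((1 + 3 * s) * ln (p * real n))"
      by (intro mult_left_mono) auto
    then have upper: "ln (real (NM V E s)) \<le> (1 + 3 * s) * (1 / 2) * real n * ln (p * real n)"
      using ln_NM_le[OF G, of s] cV n(1) by (simp add: algebra_simps)
    have lower: "(1 - 3 * s) * (1 / 2) * real n * ln (p * real n) \<le> ln (real (NM V E s))"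
    proof (cases "s \<le> 1 / 3")
      case True
      have "(1 - 3 * s) * ln (p * real n) \<le> (1 - s) * ln (c * real n) - 2 * ln 2"
        using L s unfolding L_def lnp lnc by (simp add: pos_divide_le_eq algebra_simps)
      then have "real n / 2 * ((1 - 3 * s) * ln (p * real n))
          \<le> real n / 2 * ((1 - s) * ln (c * real n) - 2 * ln 2)"
        by (intro mult_left_mono) auto
      then have "(1 - 3 * s) * (1 / 2) * real n * ln (p * real n)
          \<le> (1 - s) / 2 * real n * ln (c * real n) - real n * ln 2"
        by (simp add: field_simps)
      also have "\<dots> \<le> ln (real (NM V E s))"
        using ln_NM_ge[OF Q] assms True n cn unfolding s_def c_def by blast
      finally show ?thesis .
    next
      case False
      then have "(1 - 3 * s) * (1 / 2) * real n * ln (p * real n) \<le> 0"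
        using pn by (intro mult_nonpos_nonneg) auto
      \<comment> \<open>A natural number has nonnegative logarithm, including \<open>0\<close>,
        because \<open>ln 0 = 0\<close>.\<close>
      also have "0 \<le> ln (real (NM V E s))"
        by (cases "NM V E s = 0") auto
      finally show ?thesis .
    qed
    show "(1 - 3 * s) * (1 / 2) * real n * ln (p * real n) \<le> ln (real (NM V E s)) \<and>
        ln (real (NM V E s)) \<le> (1 + 3 * s) * (1 / 2) * real n * ln (p * real n)"
      using lower upper by blast
  qed
qed

end
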